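(* Let $G$ be a connected (simple) cubic graph of order $n$ that has a spanning $2$-factor consisting of triangles (i.e., $V(G)$ can be partitioned into sets each inducing a subgraph containing a triangle $K_3$ as spanning subgraph, so that these triangles cover every vertex exactly once). Then $F_t(G) \le \frac{n}{2}$, with equality if and only if $G$ is the prism $C_3 \,\Box\, K_2$.
   Context: Forcing process: given a graph $G$ and a set $S \subseteq V(G)$ of initially colored vertices (all others non-colored), at each step, if a colored vertex has exactly one non-colored neighbor, that neighbor becomes colored. $S$ is a forcing set (zero forcing set) if iterating this process eventually colors all of $V(G)$. A total forcing set is a forcing set $S$ such that the induced subgraph $G[S]$ has no isolated vertex. $F_t(G)$ denotes the minimum cardinality of a total forcing set of $G$. A $2$-factor is a spanning $2$-regular subgraph. The prism $C_3 \,\Box\, K_2$ is the Cartesian product of a triangle and an edge (two disjoint triangles joined by a perfect matching). *)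

theory Defs
  imports "Graph_Theory.Graph_Theory" Complex_Main
begin

text \<open>
  A finite simple graph is an instance of the locale \<^locale>\<open>graph\<close>: a finite symmetric
  digraph without loops and parallel arcs, so each edge is a pair of opposite arcs. The order
  of a graph is the cardinality of its vertex set, and the degree of a vertex is its out-degree.
\<close>

definition regular :: "nat \<Rightarrow> ('a, 'b) pre_digraph \<Rightarrow> bool" where
  "regular k G \<longleftrightarrow> (\<forall>v \<in> verts G. out_degree G v = k)"

definition nbrs :: "('a, 'b) pre_digraph \<Rightarrow> 'a \<Rightarrow> 'a set" where
  "nbrs G v = {w. v \<rightarrow>\<^bsub>G\<^esub> w}"

text \<open>
  In one step all possible forces are carried out at once. Forcing one vertex at a time leads
  to the same final set, because a force that is possible stays possible, or its target is
  already colored, when further vertices become colored.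
\<close>

definition force_step :: "('a, 'b) pre_digraph \<Rightarrow> 'a set \<Rightarrow> 'a set" where
  "force_step G C = C \<union> {v. \<exists>u \<in> C. nbrs G u - C = {v}}"

definition forcing_set :: "('a, 'b) pre_digraph \<Rightarrow> 'a set \<Rightarrow> bool" where
  "forcing_set G S \<longleftrightarrow> S \<subseteq> verts G \<and> (\<exists>k. (force_step G ^^ k) S = verts G)"

definition total_forcing_set :: "('a, 'b) pre_digraph \<Rightarrow> 'a set \<Rightarrow> bool" where
  "total_forcing_set G S \<longleftrightarrow> forcing_set G S \<and> (\<forall>v \<in> S. nbrs (G \<restriction> S) v \<noteq> {})"

text \<open>
  Meaningful if \<open>G\<close> has some total forcing set, that is, if no vertex of \<open>G\<close> is isolated;
  see \<open>total_forcing_set_verts\<close> below.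
\<close>

definition total_forcing_number :: "('a, 'b) pre_digraph \<Rightarrow> nat" where
  "total_forcing_number G = (LEAST k. \<exists>S. total_forcing_set G S \<and> card S = k)"

text \<open>
  The relation \<^const>\<open>spanning\<close> is about digraphs, so symmetry of \<open>H\<close> has to be required
  separately for \<open>H\<close> to be a subgraph in the sense of undirected graphs.
\<close>

definition two_factor :: "('a, 'b) pre_digraph \<Rightarrow> ('a, 'b) pre_digraph \<Rightarrow> bool" where
  "two_factor H G \<longleftrightarrow> spanning H G \<and> symmetric H \<and> regular 2 H"

text \<open>
  The strongly connected components of a symmetric digraph are its connected components.
\<close>

definition triangle_two_factor :: "('a, 'b) pre_digraph \<Rightarrow> ('a, 'b) pre_digraph \<Rightarrow> bool" where
  "triangle_two_factor H G \<longleftrightarrow>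
     two_factor H G \<and> (\<forall>C \<in> pre_digraph.sccs H. complete_digraph 3 C)"

text \<open>Only for \<open>n \<ge> 3\<close> is this the cycle of length \<open>n\<close>.\<close>

definition cycle_graph :: "nat \<Rightarrow> nat pair_pre_digraph" where
  "cycle_graph n = \<lparr> pverts = {..<n},
     parcs = {(i, j). i < n \<and> j < n \<and> (j = Suc i mod n \<or> i = Suc j mod n)} \<rparr>"

definition complete_graph :: "nat \<Rightarrow> nat pair_pre_digraph" where
  "complete_graph n = \<lparr> pverts = {..<n}, parcs = {(i, j). i < n \<and> j < n \<and> i \<noteq> j} \<rparr>"

definition cartesian_product ::
    "'a pair_pre_digraph \<Rightarrow> 'b pair_pre_digraph \<Rightarrow> ('a \<times> 'b) pair_pre_digraph" where
  "cartesian_product G H = \<lparr> pverts = pverts G \<times> pverts H,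
     parcs = {((a, x), (b, y)).
        (a, b) \<in> parcs G \<and> x = y \<and> x \<in> pverts H \<or>
        a = b \<and> a \<in> pverts G \<and> (x, y) \<in> parcs H} \<rparr>"

definition prism :: "(nat \<times> nat) pair_pre_digraph" where
  "prism = cartesian_product (cycle_graph 3) (complete_graph 2)"

lemma total_forcing_set_verts:
  assumes "regular k G" and "k > 0" and "wf_digraph G"
  shows "total_forcing_set G (verts G)"
proof -
  interpret wf_digraph G by fact
  have "(force_step G ^^ 0) (verts G) = verts G" by simp
  then have "forcing_set G (verts G)"
    unfolding forcing_set_def by blast
  moreover have "nbrs (G \<restriction> verts G) v \<noteq> {}" if "v \<in> verts G" for v
  proof -
    have "card (out_arcs G v) > 0"
      using assms that by (simp add: regular_def out_degree_def)
    then obtain e where "e \<in> out_arcs G v"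
      by (metis card.empty ex_in_conv less_irrefl)
    then have "head G e \<in> nbrs (G \<restriction> verts G) v"
      by (auto simp: nbrs_def arcs_ends_conv intro!: rev_image_eqI[of e])
    then show ?thesis by blast
  qed
  ultimately show ?thesis by (simp add: total_forcing_set_def)
qed

lemma total_forcing_number_attained:
  assumes "regular k G" and "k > 0" and "wf_digraph G"
  obtains S where "total_forcing_set G S" "card S = total_forcing_number G"
proof -
  have "\<exists>S. total_forcing_set G S \<and> card S = total_forcing_number G"
    unfolding total_forcing_number_def
    by (rule LeastI_ex) (use total_forcing_set_verts[OF assms] in blast)
  then show thesis using that by blast
qed

lemma graph_prism: "graph (with_proj prism)"
proof -
  have fin: "finite (parcs prism)"
    by (rule finite_subset[of _ "({..<3} \<times> {..<2}) \<times> ({..<3} \<times> {..<2})"])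
      (auto simp: prism_def cartesian_product_def cycle_graph_def complete_graph_def)
  have "pair_graph prism"
    by unfold_locales
      (use fin in \<open>auto simp: prism_def cartesian_product_def cycle_graph_def complete_graph_def
         symmetric_def mod_Suc intro!: symI split: if_splits\<close>)
  then show ?thesis by (rule pair_graph.pair_graphD_graph)
qed

end

theory Submission
  imports Defs
begin

text \<open>
  Start with one triangle and repeatedly absorb a triangle that is adjacent to the set \<open>U\<close> colored
  so far. If \<open>j\<close> edges join it to \<open>U\<close>, then two new initial vertices suffice for \<open>j = 1\<close> and none
  are needed for \<open>j = 2\<close> and \<open>j = 3\<close>. With \<open>b\<close> the number of edges leaving \<open>U\<close>, the potential
  \<open>\<bar>U\<bar> + b\<close> grows by \<open>6 - 2 * j\<close>, so twice the number of initial vertices never exceeds it, and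
  at the end, where \<open>b = 0\<close>, the bound is half the order. Every step with \<open>j = 2\<close> gains \<open>2\<close>, so
  equality forces that no such step is ever possible. Growing with \<open>j = 1\<close> only never exhausts the
  graph, since the last triangle has \<open>j = 3\<close>. Hence at some first moment a triangle has three edges
  to \<open>U\<close>, at most one of which avoids the triangle \<open>D\<close> absorbed last. At least two, and so all three,
  lead to \<open>D\<close>, which makes \<open>D\<close> the initial triangle and the graph the prism.
\<close>

section \<open>Forcing\<close>

definition force_closed :: "('a, 'b) pre_digraph \<Rightarrow> 'a set \<Rightarrow> bool" where
  "force_closed G X \<longleftrightarrow> (\<forall>u\<in>X. \<forall>v. nbrs G u - X \<noteq> {v})"

text \<open>\<open>U\<close> lies in the closure of \<open>S\<close> under forcing. Phrased through
  closed supersets, successive forces compose without any counting of steps.\<close>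

definition forces :: "('a, 'b) pre_digraph \<Rightarrow> 'a set \<Rightarrow> 'a set \<Rightarrow> bool" where
  "forces G S U \<longleftrightarrow> (\<forall>X. S \<subseteq> X \<longrightarrow> force_closed G X \<longrightarrow> U \<subseteq> X)"

lemma force_closedD:
  assumes "force_closed G X" "u \<in> X" "v \<in> nbrs G u" "nbrs G u - {v} \<subseteq> X"
  shows "v \<in> X"
proof (rule ccontr)
  assume "v \<notin> X"
  then have "nbrs G u - X = {v}" using assms by blast
  then show False using assms by (auto simp: force_closed_def)
qed

lemma force_closed_iff_fixpoint: "force_closed G X \<longleftrightarrow> force_step G X = X"
  unfolding force_closed_def force_step_def by blast

lemma subset_force_step: "X \<subseteq> force_step G X"
  by (auto simp: force_step_def)

lemma (in wf_digraph) nbrs_subset_verts: "nbrs G v \<subseteq> verts G"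
  by (auto simp: nbrs_def)

lemma (in wf_digraph) force_step_subset_verts:
  "X \<subseteq> verts G \<Longrightarrow> force_step G X \<subseteq> verts G"
  using nbrs_subset_verts unfolding force_step_def by blast

text \<open>The iterates of \<open>force_step\<close> increase inside a finite set, so one of
  maximal cardinality is a fixed point, that is, a closed superset of \<open>S\<close>.\<close>

lemma (in fin_digraph) forces_verts_imp_forcing_set:
  assumes "S \<subseteq> verts G" "forces G S (verts G)"
  shows "forcing_set G S"
proof -
  let ?X = "\<lambda>k. (force_step G ^^ k) S"
  have sub: "?X k \<subseteq> verts G" for k
    by (induction k) (auto simp: assms(1) dest!: force_step_subset_verts)
  have sup: "S \<subseteq> ?X k" for k
    by (induction k) (use subset_force_step in fastforce)+
  obtain k where k: "\<And>j. card (?X j) \<le> card (?X k)"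
  proof -
    have "\<exists>k. \<forall>j. card (?X j) \<le> card (?X k)"
      by (rule ex_has_greatest_nat[where k = 0 and P = "\<lambda>_. True" and b = "Suc (card (verts G))", simplified])
        (use sub in \<open>auto intro: card_mono[OF finite_verts] simp: less_Suc_eq_le\<close>)
    then show thesis using that by blast
  qed
  have "force_step G (?X k) = ?X k"
  proof -
    have "finite (?X (Suc k))" using sub finite_verts finite_subset by metis
    moreover have "?X k \<subseteq> ?X (Suc k)" using subset_force_step by simp
    ultimately have "?X k = ?X (Suc k)" using k[of "Suc k"] by (metis card_seteq)
    then show ?thesis by simp
  qed
  then have "verts G \<subseteq> ?X k"
    using assms(2) sup[of k] by (simp add: forces_def force_closed_iff_fixpoint)
  then have "?X k = verts G" using sub by blast
  then show ?thesis using assms(1) by (auto simp: forcing_set_def)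
qed

section \<open>Neighborhoods and a lower bound in cubic graphs\<close>

lemma (in wf_digraph) nbrs_induce: "nbrs (G \<restriction> S) v = (if v \<in> S then nbrs G v \<inter> S else {})"
  by (auto simp: nbrs_def arcs_ends_conv image_iff)

lemma (in nomulti_digraph) card_nbrs: "card (nbrs G v) = out_degree G v"
proof -
  have "nbrs G v = head G ` out_arcs G v"
    by (auto simp: nbrs_def arcs_ends_conv)
  moreover have "inj_on (head G) (out_arcs G v)"
    by (rule inj_onI) (auto simp: arc_to_ends_def intro: no_multi_arcs)
  ultimately show ?thesis by (simp add: out_degree_def card_image)
qed

lemma (in fin_digraph) finite_nbrs: "finite (nbrs G v)"
  using nbrs_subset_verts finite_verts finite_subset by blast

lemma (in graph) nbrs_sym: "v \<in> nbrs G u \<Longrightarrow> u \<in> nbrs G v"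
  by (auto simp: nbrs_def intro: arcs_ends_symmetric[OF sym_arcs])

lemma (in graph) not_in_nbrs_self: "v \<notin> nbrs G v"
  using no_loops by (auto simp: nbrs_def arcs_ends_conv)

text \<open>With at most two colored vertices, each has at most one colored neighbor and so at least
  two non-colored ones. No force ever occurs, and \<open>S\<close> would have to be the whole vertex
  set.\<close>

lemma (in graph) card_total_forcing_set_ge_3:
  assumes "regular 3 G" "card (verts G) > 2" "total_forcing_set G S"
  shows "card S \<ge> 3"
proof (rule ccontr)
  assume "\<not> card S \<ge> 3"
  have S: "S \<subseteq> verts G" "finite S" and total: "\<And>v. v \<in> S \<Longrightarrow> nbrs G v \<inter> S \<noteq> {}"
    using assms(3) finite_subset[OF _ finite_verts]
    by (auto simp: total_forcing_set_def forcing_set_def nbrs_induce)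
  have "force_closed G S"
    unfolding force_closed_def
  proof (intro ballI allI notI)
    fix u v assume u: "u \<in> S" "nbrs G u - S = {v}"
    have "card (nbrs G u) = 3"
      using assms(1) u S by (auto simp: regular_def card_nbrs)
    moreover have "card (nbrs G u \<inter> S) \<le> card (S - {u})"
      using not_in_nbrs_self S by (intro card_mono) auto
    moreover have "card (nbrs G u) = card (nbrs G u \<inter> S) + card (nbrs G u - S)"
      using finite_nbrs by (metis card_Int_Diff)
    ultimately show False using u S \<open>\<not> card S \<ge> 3\<close> by simp
  qed
  then have "(force_step G ^^ k) S = S" for k
    by (induction k) (auto simp: force_closed_iff_fixpoint)
  then have "S = verts G"
    using assms(3) by (auto simp: total_forcing_set_def forcing_set_def)
  then show False using assms(2) \<open>\<not> card S \<ge> 3\<close> by simp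
qed

section \<open>The prism\<close>

text \<open>On three vertices cyclic adjacency is mere inequality, which eliminates
  \<open>mod\<close>.\<close>

lemma parcs_prism_iff:
  "((i, s), (j, t)) \<in> parcs prism \<longleftrightarrow>
     i < 3 \<and> j < 3 \<and> s < 2 \<and> t < 2 \<and> (i \<noteq> j \<and> s = t \<or> i = j \<and> s \<noteq> t)"
proof -
  have "i < 3 \<Longrightarrow> j < 3 \<Longrightarrow> (j = Suc i mod 3 \<or> i = Suc j mod 3) \<longleftrightarrow> i \<noteq> j" for i j :: nat
    by (auto simp: mod_Suc)
  then show ?thesis
    by (auto simp: prism_def cartesian_product_def cycle_graph_def complete_graph_def)
qed

lemma pverts_prism: "pverts prism = {..<3} \<times> {..<2}"
  by (simp add: prism_def cartesian_product_def cycle_graph_def complete_graph_def)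

text \<open>Without parallel arcs an arc is determined by its ends, so a vertex bijection that
  preserves and reflects adjacency induces the map on arcs.\<close>

lemma (in graph) digraph_iso_with_projI:
  assumes "inj_on h (verts G)" "h ` verts G = pverts P" "parcs P \<subseteq> pverts P \<times> pverts P"
    and "\<And>x y. x \<in> verts G \<Longrightarrow> y \<in> verts G \<Longrightarrow> y \<in> nbrs G x \<longleftrightarrow> (h x, h y) \<in> parcs P"
  shows "digraph_iso G (with_proj P)"
proof -
  define f where "f = \<lparr>iso_verts = h, iso_arcs = (\<lambda>e. (h (tail G e), h (head G e))),
    iso_head = snd, iso_tail = fst\<rparr>"
  have "digraph_isomorphism f"
    unfolding digraph_isomorphism_def
  proof (intro conjI)
    show "inj_on (iso_arcs f) (arcs G)"
      by (rule inj_onI)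
        (auto simp: f_def arc_to_ends_def intro!: no_multi_arcs dest!: inj_onD[OF assms(1)])
  qed (use assms in \<open>auto simp: f_def wf_digraph\<close>)
  moreover have "with_proj P = app_iso f G"
  proof (rule pre_digraph.equality)
    have "parcs P = (\<lambda>e. (h (tail G e), h (head G e))) ` arcs G" (is "_ = ?R")
    proof (intro equalityI subsetI)
      fix p assume p: "p \<in> parcs P"
      then have "p \<in> h ` verts G \<times> h ` verts G" using assms(2,3) by auto
      then obtain x y where xy: "p = (h x, h y)" "x \<in> verts G" "y \<in> verts G" by auto
      then have "y \<in> nbrs G x" using p assms(4) by simp
      then show "p \<in> ?R" using xy by (auto simp: nbrs_def arcs_ends_conv)
    next
      fix p assume "p \<in> ?R"
      then obtain e where "e \<in> arcs G" "p = (h (tail G e), h (head G e))" by auto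
      moreover from this have "head G e \<in> nbrs G (tail G e)"
        by (auto simp: nbrs_def arcs_ends_conv)
      ultimately show "p \<in> parcs P" using assms(4)[of "tail G e" "head G e"] by simp
    qed
    then show "arcs (with_proj P) = arcs (app_iso f G)" by (simp add: f_def)
  qed (use assms in \<open>auto simp: f_def\<close>)
  ultimately show ?thesis unfolding digraph_iso_def by blast
qed

lemma digraph_iso_card_verts:
  assumes "digraph_iso G H"
  shows "card (verts G) = card (verts H)"
  using assms by (auto simp: digraph_iso_def pre_digraph.digraph_isomorphism_def card_image)

section \<open>Cubic graphs partitioned into triangles\<close>

text \<open>
  \<open>T v\<close> is the triangle of the partition that contains \<open>v\<close>, and \<open>m v\<close> is the neighbor of \<open>v\<close>
  outside of it.
\<close>

locale triangle_partition = graph G for G :: "('a, 'b) pre_digraph" +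
  fixes T :: "'a \<Rightarrow> 'a set" and m :: "'a \<Rightarrow> 'a"
  assumes verts_nonempty: "verts G \<noteq> {}"
    and T_subset: "v \<in> verts G \<Longrightarrow> T v \<subseteq> verts G"
    and in_T_self: "v \<in> verts G \<Longrightarrow> v \<in> T v"
    and card_T: "v \<in> verts G \<Longrightarrow> card (T v) = 3"
    and T_eq: "v \<in> verts G \<Longrightarrow> w \<in> T v \<Longrightarrow> T w = T v"
    and m_in_verts: "v \<in> verts G \<Longrightarrow> m v \<in> verts G"
    and m_m: "v \<in> verts G \<Longrightarrow> m (m v) = v"
    and m_notin_T: "v \<in> verts G \<Longrightarrow> m v \<notin> T v"
    and nbrs_eq: "v \<in> verts G \<Longrightarrow> nbrs G v = insert (m v) (T v - {v})"
    and closed_imp_verts: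
      "U \<subseteq> verts G \<Longrightarrow> U \<noteq> {} \<Longrightarrow> (\<And>u. u \<in> U \<Longrightarrow> nbrs G u \<subseteq> U) \<Longrightarrow> U = verts G"
begin

text \<open>These are the unions of triangles of the partition.\<close>

definition saturated :: "'a set \<Rightarrow> bool" where
  "saturated U \<longleftrightarrow> U \<subseteq> verts G \<and> (\<forall>v\<in>U. T v \<subseteq> U)"

definition boundary :: "'a set \<Rightarrow> 'a set" where
  "boundary U = {v \<in> U. m v \<notin> U}"

text \<open>Each edge between \<open>T w\<close> and a set \<open>U\<close> disjoint from it is
  represented by its end in \<open>T w\<close>, so the cardinality is the number \<open>j\<close> of
  joining edges.\<close>

definition links :: "'a set \<Rightarrow> 'a \<Rightarrow> 'a set" where
  "links U w = {x \<in> T w. m x \<in> U}"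

text \<open>
  \<open>boundary U\<close> is in bijection with the edges leaving \<open>U\<close>; the number \<open>k\<close> is the slack collected
  in steps that use a triangle with exactly two links.
\<close>

definition reach :: "'a set \<Rightarrow> nat \<Rightarrow> bool" where
  "reach U k \<longleftrightarrow> saturated U \<and> U \<noteq> {} \<and>
     (\<exists>S \<subseteq> U. (\<forall>v\<in>S. nbrs G v \<inter> S \<noteq> {}) \<and> forces G S U \<and>
        2 * card S + k \<le> card U + card (boundary U))"

section \<open>Absorbing triangles\<close>

lemma finite_T: "v \<in> verts G \<Longrightarrow> finite (T v)"
  using T_subset finite_verts finite_subset by blast

lemma saturated_finite: "saturated U \<Longrightarrow> finite U"
  using finite_verts finite_subset saturated_def by metis

lemma m_notin_T': "w \<in> verts G \<Longrightarrow> x \<in> T w \<Longrightarrow> m x \<notin> T w"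
  using m_notin_T T_eq T_subset by blast

lemma inj_on_m: "inj_on m (verts G)"
  by (rule inj_on_inverseI[of _ m]) (rule m_m)

lemma saturated_disjoint_T:
  "saturated U \<Longrightarrow> w \<in> verts G \<Longrightarrow> w \<notin> U \<Longrightarrow> T w \<inter> U = {}"
  using T_eq in_T_self unfolding saturated_def by blast

lemma saturated_T: "v \<in> verts G \<Longrightarrow> saturated (T v)"
  using T_eq T_subset unfolding saturated_def by blast

lemma saturated_Un: "saturated U \<Longrightarrow> saturated U' \<Longrightarrow> saturated (U \<union> U')"
  unfolding saturated_def by blast

lemma links_subset: "links U w \<subseteq> T w"
  by (auto simp: links_def)

lemma finite_links: "w \<in> verts G \<Longrightarrow> finite (links U w)"
  using finite_subset[OF links_subset finite_T] .

lemma card_links_le_3: "w \<in> verts G \<Longrightarrow> card (links U w) \<le> 3"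
  by (metis card_T card_mono finite_T links_subset)

text \<open>Each of the \<open>j\<close> links removes its end in \<open>U\<close> from the
  boundary, and the \<open>3 - j\<close> remaining vertices of \<open>T w\<close> enter it. The
  equation is arranged to avoid truncated subtraction.\<close>

lemma card_boundary_extend:
  assumes "saturated U" "w \<in> verts G" "w \<notin> U"
  shows "card (boundary (U \<union> T w)) + 2 * card (links U w) = card (boundary U) + 3"
proof -
  let ?J = "links U w"
  have disj: "T w \<inter> U = {}" using saturated_disjoint_T assms by blast
  have T: "T w \<subseteq> verts G" "U \<subseteq> verts G" using T_subset assms by (auto simp: saturated_def)
  have eq: "boundary (U \<union> T w) = (boundary U - m ` ?J) \<union> (T w - ?J)"
    using disj T m_m m_notin_T'[OF assms(2)]
    by (auto simp: boundary_def links_def image_iff subset_iff) (metis Int_iff empty_iff)+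
  have sub: "m ` ?J \<subseteq> boundary U"
  proof
    fix u assume "u \<in> m ` ?J"
    then obtain j where j: "j \<in> T w" "m j \<in> U" "u = m j" by (auto simp: links_def)
    then have "m u = j" using m_m T by auto
    then show "u \<in> boundary U" using j disj by (auto simp: boundary_def)
  qed
  have fin: "finite (boundary U)" "finite (T w)"
    using saturated_finite[OF assms(1)] finite_T[OF assms(2)] by (auto simp: boundary_def)
  have "card (m ` ?J) = card ?J"
    by (rule card_image, rule inj_on_subset[OF inj_on_m]) (use T in \<open>auto simp: links_def\<close>)
  then have 1: "card (boundary U - m ` ?J) + card ?J = card (boundary U)"
    using card_Diff_subset[OF finite_subset[OF sub fin(1)] sub] card_mono[OF fin(1) sub] by simp
  have 2: "card (T w - ?J) + card ?J = 3"
    using card_Diff_subset[OF finite_links[OF assms(2)] links_subset] card_links_le_3[OF assms(2), of U]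
      card_T[OF assms(2)] by simp
  have "card (boundary (U \<union> T w)) = card (boundary U - m ` ?J) + card (T w - ?J)"
    unfolding eq using disj fin by (intro card_Un_disjoint) (auto simp: boundary_def)
  then show ?thesis using 1 2 by linarith
qed

lemma card_extend:
  assumes "saturated U" "w \<in> verts G" "w \<notin> U"
  shows "card (U \<union> T w) = card U + 3"
  using saturated_disjoint_T[OF assms] saturated_finite[OF assms(1)] finite_T[OF assms(2)]
    card_T[OF assms(2)] by (subst card_Un_disjoint) auto

text \<open>The triangle of \<open>m x\<close> lies in \<open>U\<close> and is colored, so
  \<open>x\<close> is the only neighbor of \<open>m x\<close> that can be non-colored.\<close>

lemma link_forced:
  assumes "saturated U" "U \<subseteq> X" "force_closed G X" "x \<in> verts G" "m x \<in> U"
  shows "x \<in> X"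
proof (rule force_closedD[OF assms(3)])
  have eq: "nbrs G (m x) = insert x (T (m x) - {m x})"
    using nbrs_eq[OF m_in_verts[OF assms(4)]] m_m[OF assms(4)] by simp
  show "m x \<in> X" using assms by blast
  show "x \<in> nbrs G (m x)" unfolding eq by blast
  show "nbrs G (m x) - {x} \<subseteq> X"
    using assms(1,2,5) unfolding eq saturated_def by blast
qed

text \<open>The vertex \<open>x\<close> has its outer neighbor and its triangle except
  \<open>y\<close> colored, so it forces \<open>y\<close>.\<close>

lemma triangle_completed:
  assumes "force_closed G X" "w \<in> verts G" "x \<in> T w" "m x \<in> X" "T w - {y} \<subseteq> X" "x \<noteq> y"
  shows "T w \<subseteq> X"
proof (cases "y \<in> T w")
  case True
  have "x \<in> verts G" using T_subset[OF assms(2)] assms(3) by blast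
  then have eq: "nbrs G x = insert (m x) (T w - {x})"
    using nbrs_eq T_eq[OF assms(2,3)] by simp
  have "y \<in> X"
  proof (rule force_closedD[OF assms(1)])
    show "x \<in> X" using assms(3,5,6) by blast
    show "y \<in> nbrs G x" using True assms(6) unfolding eq by blast
    show "nbrs G x - {y} \<subseteq> X" using assms(4,5) unfolding eq by blast
  qed
  then show ?thesis using assms by blast
qed (use assms in auto)

text \<open>With one link, \<open>w\<close> and a second vertex of its triangle are added to
  \<open>S\<close>, and \<open>w\<close> forces the third. With two links, \<open>U\<close> forces
  both linked vertices, one of which is \<open>w\<close>, and \<open>w\<close> forces the third.
  With three links, \<open>U\<close> forces the whole triangle.\<close>

lemma reach_extend:
  assumes "reach U k" "w \<in> verts G" "w \<notin> U" "m w \<in> U"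
  shows "reach (U \<union> T w) (if card (links U w) = 2 then k + 2 else k)"
proof -
  obtain S where sat: "saturated U" "U \<noteq> {}" and S: "S \<subseteq> U" "\<forall>v\<in>S. nbrs G v \<inter> S \<noteq> {}"
    "forces G S U" "2 * card S + k \<le> card U + card (boundary U)"
    using assms(1) unfolding reach_def by blast
  let ?U = "U \<union> T w" and ?J = "links U w"
  have sat': "saturated ?U" "?U \<noteq> {}" using sat saturated_Un saturated_T assms by auto
  have T: "T w \<subseteq> verts G" using T_subset assms(2) .
  have w: "w \<in> ?J" using in_T_self assms by (simp add: links_def)
  have fin: "finite ?J" using finite_links assms(2) .
  \<comment> \<open>The order grows by \<open>3\<close> and the boundary by
    \<open>3 - 2 * j\<close>, which gives the change \<open>6 - 2 * j\<close> of the
    potential.\<close>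
  have pot: "card ?U + card (boundary ?U) + 2 * card ?J = card U + card (boundary U) + 6"
    using card_boundary_extend[OF sat(1) assms(2,3)] card_extend[OF sat(1) assms(2,3)] by simp
  have "card ?J \<noteq> 0" using w fin by auto
  then consider "card ?J = 1" | "card ?J = 2" | "card ?J = 3"
    using card_links_le_3[OF assms(2), of U] by linarith
  then show ?thesis
  proof cases
    case 1
    obtain x where x: "x \<in> T w" "x \<noteq> w"
    proof -
      have "T w \<noteq> {w}" using card_T[OF assms(2)] by auto
      then show thesis using that in_T_self[OF assms(2)] by blast
    qed
    have "card (T w - {w, x}) = 1"
      using card_T[OF assms(2)] x in_T_self[OF assms(2)] by (subst card_Diff_subset) auto
    then obtain y where "T w - {w, x} = {y}" by (auto simp: card_1_singleton_iff)
    then have y: "T w = {w, x, y}" "y \<noteq> w" "y \<noteq> x" using x in_T_self[OF assms(2)] by auto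
    let ?S = "insert w (insert x S)"
    have "x \<in> nbrs G w" "w \<in> nbrs G x"
      using nbrs_eq[OF assms(2)] x nbrs_sym by auto
    then have total: "\<forall>v\<in>?S. nbrs G v \<inter> ?S \<noteq> {}" using S(2) by blast
    have "forces G ?S ?U"
      unfolding forces_def
    proof (intro allI impI)
      fix X assume X: "?S \<subseteq> X" "force_closed G X"
      then have "U \<subseteq> X" using S(3) by (auto simp: forces_def)
      moreover have "T w \<subseteq> X"
        by (rule triangle_completed[OF X(2) assms(2), of w y])
          (use X y assms \<open>U \<subseteq> X\<close> in auto)
      ultimately show "?U \<subseteq> X" by blast
    qed
    \<comment> \<open>Two new initial vertices cost \<open>4\<close>, exactly the gain for
      \<open>j = 1\<close>.\<close>
    moreover have "card ?S \<le> card S + 2"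
      using finite_subset[OF S(1) saturated_finite[OF sat(1)]] by (simp add: card_insert_if)
    ultimately show ?thesis
      using sat' S total pot 1 x in_T_self[OF assms(2)] unfolding reach_def
      by (auto intro!: exI[of _ ?S])
  next
    case 2
    have "card (T w - ?J) = 1"
      using 2 card_Diff_subset[OF fin links_subset] card_T[OF assms(2)] by simp
    then obtain y where y: "T w - ?J = {y}" by (auto simp: card_1_singleton_iff)
    have "forces G S ?U"
      unfolding forces_def
    proof (intro allI impI)
      fix X assume X: "S \<subseteq> X" "force_closed G X"
      then have U: "U \<subseteq> X" using S(3) by (auto simp: forces_def)
      have J: "?J \<subseteq> X"
        using link_forced[OF sat(1) U X(2)] T by (auto simp: links_def)
      have "T w \<subseteq> X"
        by (rule triangle_completed[OF X(2) assms(2), of w y])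
          (use J y assms U w in_T_self[OF assms(2)] in auto)
      then show "?U \<subseteq> X" using U by blast
    qed
    \<comment> \<open>Nothing is added to \<open>S\<close>, so the whole gain \<open>6 - 4\<close>
      becomes slack.\<close>
    then show ?thesis
      using sat' S pot 2 unfolding reach_def by (auto intro!: exI[of _ S])
  next
    case 3
    have "?J = T w"
      using 3 card_subset_eq[OF finite_T links_subset] card_T assms(2) by simp
    then have J: "m x \<in> U" if "x \<in> T w" for x using that by (auto simp: links_def)
    have "forces G S ?U"
      unfolding forces_def
    proof (intro allI impI)
      fix X assume X: "S \<subseteq> X" "force_closed G X"
      then have U: "U \<subseteq> X" using S(3) by (auto simp: forces_def)
      then have "T w \<subseteq> X" using link_forced[OF sat(1) U X(2)] T J by blast
      then show "?U \<subseteq> X" using U by blast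
    qed
    then show ?thesis
      using sat' S pot 3 unfolding reach_def by (auto intro!: exI[of _ S])
  qed
qed

text \<open>All three vertices are initial and all three are boundary vertices, so the inequality is
  tight: \<open>2 * 3 = 3 + 3\<close>.\<close>

lemma reach_T:
  assumes "v \<in> verts G"
  shows "reach (T v) 0"
proof -
  have "boundary (T v) = T v"
    using m_notin_T'[OF assms] by (auto simp: boundary_def)
  moreover have "nbrs G x \<inter> T v \<noteq> {}" if "x \<in> T v" for x
  proof -
    have "T v \<noteq> {x}" using card_T[OF assms] by auto
    moreover have "nbrs G x = insert (m x) (T v - {x})"
      using that T_subset T_eq assms nbrs_eq by (metis subsetD)
    ultimately show ?thesis using that by blast
  qed
  moreover have "forces G (T v) (T v)" by (auto simp: forces_def)
  moreover have "saturated (T v)" "T v \<noteq> {}" using saturated_T in_T_self assms by auto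
  ultimately show ?thesis unfolding reach_def by (auto intro!: exI[of _ "T v"])
qed

text \<open>Connectivity enters here through \<open>closed_imp_verts\<close>. An edge leaving a
  union of triangles is no triangle edge, hence joins some \<open>u\<close> to
  \<open>m u\<close>.\<close>

lemma exists_link:
  assumes "saturated U" "U \<noteq> {}" "U \<noteq> verts G"
  obtains w where "w \<in> verts G" "w \<notin> U" "m w \<in> U"
proof -
  obtain u x where u: "u \<in> U" "x \<in> nbrs G u" "x \<notin> U"
    using closed_imp_verts[of U] assms unfolding saturated_def by blast
  then have "u \<in> verts G" using assms by (auto simp: saturated_def)
  moreover have "m u = x"
    using u assms nbrs_eq[OF \<open>u \<in> verts G\<close>] by (auto simp: saturated_def)
  ultimately show thesis using that[of x] u m_m m_in_verts by auto
qed

lemma reach_verts: "reach U k \<Longrightarrow> \<exists>k'\<ge>k. reach (verts G) k'"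
proof (induction "card (verts G - U)" arbitrary: U k rule: less_induct)
  case less
  show ?case
  proof (cases "U = verts G")
    case False
    have sat: "saturated U" "U \<noteq> {}" using less.prems by (auto simp: reach_def)
    obtain w where w: "w \<in> verts G" "w \<notin> U" "m w \<in> U"
      using exists_link[OF sat False] .
    obtain k' where k': "k' \<ge> k" "reach (U \<union> T w) k'"
      using reach_extend[OF less.prems w] by (metis le_add1 order_refl)
    have "card (verts G - (U \<union> T w)) < card (verts G - U)"
      using w in_T_self by (intro psubset_card_mono) auto
    then show ?thesis using less.hyps k' order_trans by blast
  qed (use less.prems in auto)
qed

text \<open>Once everything is absorbed the boundary is empty, and the potential is the order of the
  graph.\<close>

lemma total_forcing_number_le:
  assumes "reach U k"
  shows "2 * total_forcing_number G + k \<le> card (verts G)"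
proof -
  obtain k' where k': "k' \<ge> k" "reach (verts G) k'" using reach_verts[OF assms] by blast
  have "boundary (verts G) = {}" using m_in_verts by (auto simp: boundary_def)
  then obtain S where S: "S \<subseteq> verts G" "\<forall>v\<in>S. nbrs G v \<inter> S \<noteq> {}" "forces G S (verts G)"
    "2 * card S + k' \<le> card (verts G)"
    using k'(2) by (auto simp: reach_def)
  then have "total_forcing_set G S"
    by (simp add: total_forcing_set_def forces_verts_imp_forcing_set nbrs_induce)
  then have "total_forcing_number G \<le> card S"
    unfolding total_forcing_number_def by (intro Least_le) auto
  then show ?thesis using S k' by linarith
qed

section \<open>Two triangles joined by three edges\<close>

text \<open>The three edges match the two triangles perfectly and use up every outer edge, so the
  union is closed under adjacency and connectivity makes it the whole graph.\<close>

lemma links_3_imp_verts: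
  assumes "v \<in> verts G" "w \<in> verts G" "w \<notin> T v" "card (links (T v) w) = 3"
  shows "verts G = T v \<union> T w" "\<And>x. x \<in> T v \<Longrightarrow> m x \<in> T w" "\<And>x. x \<in> T w \<Longrightarrow> m x \<in> T v"
proof -
  have "links (T v) w = T w"
    using assms card_subset_eq[OF finite_T links_subset] card_T by simp
  then show w: "\<And>x. x \<in> T w \<Longrightarrow> m x \<in> T v" by (auto simp: links_def)
  have T: "T v \<subseteq> verts G" "T w \<subseteq> verts G" using T_subset assms by auto
  \<comment> \<open>Injectivity of \<open>m\<close> gives the image three elements, as many as
    \<open>T v\<close> has.\<close>
  have "m ` T w = T v"
    by (rule card_subset_eq)
      (use w T assms finite_T card_T card_image[OF inj_on_subset[OF inj_on_m]] in auto)
  then show v: "\<And>x. x \<in> T v \<Longrightarrow> m x \<in> T w" using m_m T by (metis imageE subsetD)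
  have "T v \<union> T w = verts G"
  proof (rule closed_imp_verts)
    show "T v \<union> T w \<noteq> {}" using in_T_self assms by blast
    fix u assume u: "u \<in> T v \<union> T w"
    have "u \<in> verts G" using u T by blast
    moreover have "T u \<subseteq> T v \<union> T w" using u T_eq assms(1,2) by blast
    moreover have "m u \<in> T v \<union> T w" using u v w by blast
    ultimately show "nbrs G u \<subseteq> T v \<union> T w" using nbrs_eq by auto
  qed (use T in auto)
  then show "verts G = T v \<union> T w" ..
qed

lemma digraph_iso_prism:
  assumes "v \<in> verts G" "w \<in> verts G" "w \<notin> T v" "card (links (T v) w) = 3"
  shows "digraph_iso G (with_proj prism)"
proof -
  note L = links_3_imp_verts[OF assms]
  obtain i where i: "bij_betw i (T v) {..<3::nat}"
    using ex_bij_betw_finite_nat[OF finite_T] card_T assms(1) by (metis atLeast0LessThan)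
  have disj: "T w \<inter> T v = {}"
    using saturated_disjoint_T[OF saturated_T] assms by blast
  have TT: "T x = T v" if "x \<in> T v" for x using that T_eq assms by blast
  have TT': "T x = T w" if "x \<in> T w" for x using that T_eq assms by blast
  have sub: "T v \<subseteq> verts G" "T w \<subseteq> verts G" using T_subset assms by auto
  \<comment> \<open>A vertex of \<open>T w\<close> inherits the number of its partner in
    \<open>T v\<close>; the second coordinate tells the triangles apart.\<close>
  define h where "h x = (if x \<in> T v then (i x, 0::nat) else (i (m x), 1))" for x
  have inj: "i x = i y \<longleftrightarrow> x = y" if "x \<in> T v" "y \<in> T v" for x y
    using i that by (auto simp: bij_betw_def inj_on_def)
  have lt: "i x < 3" if "x \<in> T v" for x using i that by (auto simp: bij_betw_def)
  have m_eq: "m x = m y \<longleftrightarrow> x = y" if "x \<in> verts G" "y \<in> verts G" for x y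
    using inj_on_m that by (auto dest: inj_onD)
  show ?thesis
  proof (rule digraph_iso_with_projI)
    show "inj_on h (verts G)"
      by (rule inj_onI) (use L disj inj m_eq in \<open>auto simp: h_def split: if_splits\<close>)
    show "h ` verts G = pverts prism"
    proof
      show "h ` verts G \<subseteq> pverts prism"
        using L lt by (auto simp: h_def pverts_prism)
      show "pverts prism \<subseteq> h ` verts G"
      proof
        fix p assume "p \<in> pverts prism"
        then obtain k s where p: "p = (k, s)" "k < 3" "s < 2" by (auto simp: pverts_prism)
        then have "k \<in> i ` T v" using i by (simp add: bij_betw_def)
        then obtain x where x: "x \<in> T v" "i x = k" by blast
        then have "x \<in> verts G" "h x = (k, 0)" "h (m x) = (k, 1)" "m x \<in> verts G"
          using sub m_m m_in_verts m_notin_T'[OF assms(1)] by (auto simp: h_def)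
        moreover have "s = 0 \<or> s = 1" using p by auto
        ultimately show "p \<in> h ` verts G" using p by (metis image_eqI)
      qed
    qed
    show "parcs prism \<subseteq> pverts prism \<times> pverts prism"
      by (auto simp: parcs_prism_iff pverts_prism)
    fix x y assume xy: "x \<in> verts G" "y \<in> verts G"
    \<comment> \<open>For \<open>y\<close> in \<open>T w\<close> the value \<open>h y\<close> is
      computed from \<open>m y\<close>, so adjacency has to be read from that side.\<close>
    have swap: "y = m x \<longleftrightarrow> x = m y" using xy m_m by auto
    have nbrs_x: "y \<in> nbrs G x \<longleftrightarrow> y = m x \<or> y \<in> T x \<and> y \<noteq> x"
      using nbrs_eq[OF xy(1)] by auto
    consider "x \<in> T v" "y \<in> T v" | "x \<in> T v" "y \<in> T w" | "x \<in> T w" "y \<in> T v" | "x \<in> T w" "y \<in> T w"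
      using xy L(1) by blast
    then show "y \<in> nbrs G x \<longleftrightarrow> (h x, h y) \<in> parcs prism"
    proof cases
      case 1
      then have "T x = T v" "y \<noteq> m x" using TT L(2) disj by blast+
      then show ?thesis using 1 lt inj unfolding nbrs_x by (auto simp: h_def parcs_prism_iff)
    next
      case 2
      then have "y \<notin> T v" "m y \<in> T v" "T x = T v" using TT L(3) disj by blast+
      then show ?thesis
        using 2 lt inj swap unfolding nbrs_x by (simp add: h_def parcs_prism_iff)
    next
      case 3
      then have "x \<notin> T v" "y \<notin> T w" "m x \<in> T v" "T x = T w" using TT' L(3) disj by blast+
      then show ?thesis
        using 3 lt inj unfolding nbrs_x by (auto simp: h_def parcs_prism_iff)
    next
      case 4
      then have "x \<notin> T v" "y \<notin> T v" "m x \<in> T v" "m y \<in> T v" "T x = T w" "y \<noteq> m x"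
        using TT' L(3) disj by blast+
      then show ?thesis
        using 4 lt inj m_eq[OF xy] unfolding nbrs_x by (auto simp: h_def parcs_prism_iff)
    qed
  qed
qed

section \<open>Growth by single links\<close>

text \<open>Unlike \<open>reach\<close>, this keeps the history of the growth: the argument below is
  an induction that inspects the triangle absorbed last.\<close>

inductive grown :: "'a set \<Rightarrow> bool" where
  grown_T: "v \<in> verts G \<Longrightarrow> grown (T v)"
| grown_extend: "grown U \<Longrightarrow> w \<in> verts G \<Longrightarrow> w \<notin> U \<Longrightarrow> m w \<in> U \<Longrightarrow> card (links U w) = 1
    \<Longrightarrow> grown (U \<union> T w)"

lemma grown_reach: "grown U \<Longrightarrow> reach U 0"
proof (induction rule: grown.induct)
  case (grown_extend U w)
  then show ?case using reach_extend[of U 0 w] by simp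
qed (rule reach_T)

lemma grown_saturated: "grown U \<Longrightarrow> saturated U"
  using grown_reach by (auto simp: reach_def)

text \<open>Outer edges leave their own triangle, so a triangle that completes the graph has three
  links, not one.\<close>

lemma grown_neq_verts: "grown U \<Longrightarrow> U \<noteq> verts G"
proof (induction rule: grown.induct)
  case (grown_T v)
  then show ?case using m_notin_T m_in_verts by blast
next
  case (grown_extend U w)
  show ?case
  proof
    assume "U \<union> T w = verts G"
    then have "links U w = T w"
      using m_notin_T'[OF grown_extend(2)] m_in_verts by (auto simp: links_def)
    then show False using grown_extend card_T by simp
  qed
qed

lemma links_Un: "links (U \<union> U') w = links U w \<union> links U' w"
  by (auto simp: links_def)

text \<open>As \<open>w\<close> itself may carry no link, a linked vertex \<open>x\<close> of the
  same triangle takes its place in \<open>reach_extend\<close>.\<close>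

lemma two_links_reach:
  assumes "reach U 0" "w \<in> verts G" "w \<notin> U" "card (links U w) = 2"
  shows "\<exists>U. reach U 2"
proof -
  have "links U w \<noteq> {}" using assms(4) by auto
  then obtain x where x: "x \<in> T w" "m x \<in> U" by (auto simp: links_def)
  have "T x = T w" using T_eq[OF assms(2) x(1)] .
  moreover have "x \<in> verts G" using T_subset[OF assms(2)] x(1) by blast
  moreover have "x \<notin> U"
    using x saturated_disjoint_T assms by (auto simp: reach_def)
  ultimately have "reach (U \<union> T x) 2"
    using reach_extend[OF assms(1), of x] x assms(4) by (simp add: links_def numeral_2_eq_2)
  then show ?thesis by blast
qed

text \<open>Two links would create slack \<open>2\<close>. Three links to a single initial triangle
  give the prism; three links after a step contradict the single link by which the last triangle was
  attached.\<close>

lemma grown_card_links_le_1: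
  assumes "grown U" "w \<in> verts G" "w \<notin> U"
    and "\<not> digraph_iso G (with_proj prism)" "\<nexists>U. reach U 2"
  shows "card (links U w) \<le> 1"
  using assms(1-3)
proof (induction arbitrary: w rule: grown.induct)
  case (grown_T v)
  then have "card (links (T v) w) \<noteq> 2" "card (links (T v) w) \<noteq> 3"
    using two_links_reach reach_T digraph_iso_prism assms(4,5) by blast+
  then show ?case
    using card_links_le_3[OF grown_T(2), of "T v"] by linarith
next
  case (grown_extend U y)
  have w: "w \<in> verts G" "w \<notin> U" "w \<notin> T y" using grown_extend by auto
  have "card (links (U \<union> T y) w) \<noteq> 2"
    using two_links_reach[OF grown_reach[OF grown.grown_extend]] grown_extend assms(5) by blast
  moreover have "card (links (U \<union> T y) w) \<noteq> 3"
  proof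
    assume "card (links (U \<union> T y) w) = 3"
    moreover have "card (links (U \<union> T y) w) \<le> card (links U w) + card (links (T y) w)"
      by (simp add: links_Un card_Un_le)
    moreover have "card (links U w) \<le> 1" using grown_extend.IH w by blast
    \<comment> \<open>Restarting the growth from \<open>T y\<close> alone, two links would already
      create slack. At most one link goes to \<open>U\<close>, so all three go to
      \<open>T y\<close>.\<close>
    moreover have "card (links (T y) w) \<noteq> 2"
      using two_links_reach[OF reach_T] w grown_extend assms(5) by blast
    ultimately have "card (links (T y) w) = 3"
      using card_links_le_3[OF w(1), of "T y"] by linarith
    \<comment> \<open>The outer edge of \<open>y\<close> would have to lead to \<open>T w\<close>,
      but it leads to \<open>U\<close>.\<close>
    then have "m y \<in> T w"
      using links_3_imp_verts(2)[of y w y] w grown_extend in_T_self by blast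
    then show False
      using saturated_disjoint_T[OF grown_saturated] w grown_extend by blast
  qed
  ultimately show ?case using card_links_le_3[OF w(1), of "U \<union> T y"] by linarith
qed

text \<open>A maximal grown set is not the whole graph, so some triangle is linked to it. If slack
  \<open>2\<close> were impossible, the link would be single and the set could grow further.\<close>

lemma reach_2:
  assumes "\<not> digraph_iso G (with_proj prism)"
  shows "\<exists>U. reach U 2"
proof (rule ccontr)
  assume no: "\<nexists>U. reach U 2"
  have fin: "finite {U. grown U}"
    by (rule finite_subset[of _ "Pow (verts G)"])
      (use grown_saturated in \<open>auto simp: saturated_def\<close>)
  obtain v where "v \<in> verts G" using verts_nonempty by blast
  then have "{U. grown U} \<noteq> {}" using grown_T by blast
  then obtain U where U: "grown U" "\<And>U'. grown U' \<Longrightarrow> U \<subseteq> U' \<Longrightarrow> U = U'"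
    using finite_has_maximal[OF fin] by auto
  have "U \<noteq> {}" using grown_reach[OF U(1)] by (simp add: reach_def)
  then obtain w where w: "w \<in> verts G" "w \<notin> U" "m w \<in> U"
    using exists_link[OF grown_saturated[OF U(1)] _ grown_neq_verts[OF U(1)]] by blast
  have "links U w \<noteq> {}" using w in_T_self by (auto simp: links_def)
  then have "card (links U w) \<noteq> 0" using finite_links w by simp
  then have "card (links U w) = 1"
    using grown_card_links_le_1[OF U(1) w(1,2) assms no] by linarith
  then have "U = U \<union> T w" using U grown_extend w by blast
  then show False using w in_T_self by blast
qed

lemma total_forcing_number_bounds:
  shows "2 * total_forcing_number G \<le> card (verts G)"
    and "\<not> digraph_iso G (with_proj prism) \<Longrightarrow> 2 * total_forcing_number G < card (verts G)"
proof -
  obtain v where "v \<in> verts G" using verts_nonempty by blast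
  then show "2 * total_forcing_number G \<le> card (verts G)"
    using total_forcing_number_le[OF reach_T] by simp
  show "2 * total_forcing_number G < card (verts G)" if "\<not> digraph_iso G (with_proj prism)"
    using reach_2[OF that] total_forcing_number_le by fastforce
qed

end

section \<open>The partition given by a triangle factor\<close>

lemma (in graph) connected_closed_imp_verts:
  assumes "connected G" "U \<subseteq> verts G" "U \<noteq> {}" "\<And>u. u \<in> U \<Longrightarrow> nbrs G u \<subseteq> U"
  shows "U = verts G"
proof -
  obtain u where u: "u \<in> U" using assms by blast
  have "v \<in> U" if "v \<in> verts G" for v
  proof -
    have "u \<rightarrow>\<^sup>* v"
      using assms(1,2) u that reachable_mk_symmetric_eq[OF sym_arcs]
      by (auto simp: connected_def strongly_connected_def)
    then show "v \<in> U"
      by (induction rule: reachable_induct) (use u assms(4) in \<open>auto simp: nbrs_def\<close>)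
  qed
  then show ?thesis using assms(2) by blast
qed

text \<open>The triangles are the components of \<open>H\<close>; degree \<open>3\<close> leaves
  each vertex exactly one neighbor outside its own triangle.\<close>

lemma (in graph) triangle_two_factor_imp_partition:
  assumes "connected G" "regular 3 G" "triangle_two_factor H G"
  obtains T m where "triangle_partition G T m"
proof -
  have H: "subgraph H G" "verts H = verts G"
    and tri: "\<And>C. C \<in> pre_digraph.sccs H \<Longrightarrow> complete_digraph 3 C"
    using assms(3) by (auto simp: triangle_two_factor_def two_factor_def spanning_def)
  interpret H: wf_digraph H using H(1) by (simp add: subgraph_def)
  define T where "T = pre_digraph.scc_of H"
  have self: "v \<in> T v" if "v \<in> verts G" for v
    using that H H.in_scc_of_self by (simp add: T_def)
  have sub: "T v \<subseteq> verts G" if "v \<in> verts G" for v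
    using that H H.sccs_verts_subsets[OF H.scc_of_in_sccs_verts] by (simp add: T_def)
  have T_eq: "T w = T v" if "w \<in> T v" for v w
    using that H.scc_of_eq by (simp add: T_def)
  have K: "complete_digraph 3 (H \<restriction> T v)" if "v \<in> verts G" for v
    using that H H.scc_of_in_sccs_verts H.in_verts_sccsD_sccs tri by (simp add: T_def)
  have card_T: "card (T v) = 3" if "v \<in> verts G" for v
    using K[OF that] by (simp add: complete_digraph_def)
  have T_nbrs: "T v - {v} \<subseteq> nbrs G v" if "v \<in> verts G" for v
  proof
    fix x assume "x \<in> T v - {v}"
    then have "(v, x) \<in> arcs_ends (H \<restriction> T v)"
      using K[OF that] self[OF that] by (auto simp: complete_digraph_def)
    then have "(v, x) \<in> arcs_ends H" by (auto simp: arcs_ends_conv)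
    then show "x \<in> nbrs G v"
      using H(1) by (auto simp: nbrs_def arcs_ends_conv subgraph_def compatible_def)
  qed
  have ex1: "\<exists>x. nbrs G v - T v = {x}" if "v \<in> verts G" for v
  proof -
    have "finite (T v)" using sub[OF that] finite_verts finite_subset by blast
    then have "card (T v - {v}) = 2" using card_T self that by simp
    moreover have "card (nbrs G v) = 3"
      using assms(2) that by (simp add: card_nbrs regular_def)
    moreover have "nbrs G v - T v = nbrs G v - (T v - {v})" using not_in_nbrs_self by blast
    ultimately have "card (nbrs G v - T v) = 1"
      using card_Diff_subset[OF _ T_nbrs[OF that]] \<open>finite (T v)\<close> by simp
    then show ?thesis by (simp add: card_1_singleton_iff)
  qed
  define m where "m v = (THE x. nbrs G v - T v = {x})" for v
  have m: "nbrs G v - T v = {m v}" if "v \<in> verts G" for v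
    using ex1[OF that] by (auto simp: m_def)
  have m_verts: "m v \<in> verts G" if "v \<in> verts G" for v
    using m[OF that] nbrs_subset_verts by blast
  have "triangle_partition G T m"
  proof unfold_locales
    show "verts G \<noteq> {}"
      using assms(1) by (auto simp: connected_def strongly_connected_def)
    fix v assume v: "v \<in> verts G"
    show "m v \<notin> T v" using m[OF v] by blast
    show "nbrs G v = insert (m v) (T v - {v})"
      using m[OF v] T_nbrs[OF v] not_in_nbrs_self by blast
    show "m (m v) = v"
    proof -
      \<comment> \<open>The vertex \<open>v\<close> is a neighbor of \<open>m v\<close> outside the
        triangle of \<open>m v\<close>, and such a neighbor is unique.\<close>
      have "v \<in> nbrs G (m v)" using m[OF v] nbrs_sym by blast
      moreover have "v \<notin> T (m v)"
        using T_eq self[OF m_verts[OF v]] m[OF v] by blast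
      ultimately have "v \<in> nbrs G (m v) - T (m v)" by blast
      then show ?thesis unfolding m[OF m_verts[OF v]] by simp
    qed
  next
    fix U assume "U \<subseteq> verts G" "U \<noteq> {}" "\<And>u. u \<in> U \<Longrightarrow> nbrs G u \<subseteq> U"
    then show "U = verts G" using connected_closed_imp_verts assms(1) by blast
  qed (use sub self card_T T_eq m_verts in auto)
  then show thesis using that by blast
qed

theorem theorem1:
  fixes G :: "('a, 'b) pre_digraph"
  assumes "graph G"
    and "Digraph_Component.connected G"
    and "regular 3 G"
    and "\<exists>H. triangle_two_factor H G"
  shows "real (total_forcing_number G) \<le> real (card (verts G)) / 2 \<and>
         (real (total_forcing_number G) = real (card (verts G)) / 2
            \<longleftrightarrow> digraph_iso G (with_proj prism))"
proof -
  interpret graph G by fact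
  obtain T m where "triangle_partition G T m"
    using triangle_two_factor_imp_partition assms by blast
  then interpret triangle_partition G T m .
  \<comment> \<open>For the prism, of order \<open>6\<close>, the upper bound \<open>3\<close> meets
    the lower bound \<open>3\<close>. The other direction is the strict bound for all other
    graphs.\<close>
  have "2 * total_forcing_number G = card (verts G)" if "digraph_iso G (with_proj prism)"
  proof -
    have 6: "card (verts G) = 6"
      using digraph_iso_card_verts[OF that] by (simp add: pverts_prism)
    obtain S where "total_forcing_set G S" "card S = total_forcing_number G"
      using total_forcing_number_attained[OF assms(3)] wf_digraph by auto
    then have "total_forcing_number G \<ge> 3"
      using card_total_forcing_set_ge_3[OF assms(3)] 6 by fastforce
    then show ?thesis using total_forcing_number_bounds(1) 6 by simp
  qed
  then show ?thesis using total_forcing_number_bounds by fastforce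
qed

end
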